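(* For every integer $r\ge0$ and every integer $n\ge0$, \[ B^{(r)}_{n,\lambda}(x,y)=e_\lambda^{y-1}(x)\sum_{k=0}^{n}(y)_{k,\lambda}\Big(\frac{x}{1+\lambda x}\Big)^k{n+r\brace k+r}_{r,\lambda}. \] In particular, for $y=1$, \[ B^{(r)}_{n,\lambda}(x,1)=\sum_{k=0}^{n}(1)_{k,\lambda}\Big(\frac{x}{1+\lambda x}\Big)^k{n+r\brace k+r}_{r,\lambda}=B^{(r)}_{n,\lambda}(x). \]
   Context: Let $\lambda$ be a fixed nonzero real number and $r\ge0$ an integer. The degenerate falling factorial is $(x)_{0,\lambda}=1$ and $(x)_{n,\lambda}=x(x-\lambda)\cdots(x-(n-1)\lambda)$ for $n\ge1$. The degenerate exponential is $e_\lambda^{x}(t)=(1+\lambda t)^{x/\lambda}=\sum_{n\ge0}(x)_{n,\lambda}\frac{t^n}{n!}$, and $e_\lambda(t)=e_\lambda^1(t)$. The degenerate $r$-Stirling numbers of the second kind are defined by $\frac{1}{k!}(e_\lambda(t)-1)^k e_\lambda^{r}(t)=\sum_{n\ge k}{n+r\brace k+r}_{r,\lambda}\frac{t^n}{n!}$ for $k\ge0$. For real $x,y$ with $1+\lambda x>0$, the fully degenerate $r$-Bell polynomials $B^{(r)}_{n,\lambda}(x)$ and the two variable fully degenerate $r$-Bell polynomials $B^{(r)}_{n,\lambda}(x,y)$ are defined by the formal power series identities in $t$ \[ \frac{e_\lambda(xe_\lambda(t))\,e_\lambda^r(t)}{e_\lambda(x)}=\sum_{n\ge0}B^{(r)}_{n,\lambda}(x)\frac{t^n}{n!},\qquad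 \frac{e^y_\lambda(xe_\lambda(t))\,e_\lambda^r(t)}{e_\lambda(x)}=\sum_{n\ge0}B^{(r)}_{n,\lambda}(x,y)\frac{t^n}{n!}, \] where $e_\lambda^{y}(xe_\lambda(t))=(1+\lambda x e_\lambda(t))^{y/\lambda}$ and $e_\lambda^{y}(x)=(1+\lambda x)^{y/\lambda}$. *)

theory Defs
  imports "HOL-Analysis.Analysis"
begin

text \<open>
  The real power \<open>F\<^sup>a\<close> of a formal power series with positive constant term \<open>c\<close>: writing
  \<open>F = c (1 + U)\<close> with \<open>U\<close> without constant term, it is \<open>c\<^sup>a\<close> times the binomial series
  \<open>(1 + U)\<^sup>a = (\<Sum>k. (a gchoose k) U\<^sup>k)\<close>. The value is meaningless if \<open>c \<le> 0\<close>.
\<close>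

definition fps_rpow :: "real fps \<Rightarrow> real \<Rightarrow> real fps" where
  "fps_rpow F a =
     fps_const (fps_nth F 0 powr a) * (fps_binomial a oo (F / fps_const (fps_nth F 0) - 1))"

definition deg_ffact :: "real \<Rightarrow> real \<Rightarrow> nat \<Rightarrow> real" where
  "deg_ffact l x n = (\<Prod>i<n. x - real i * l)"

text \<open>
  The degenerate exponential \<open>e\<^sub>l\<^sup>y(u) = (1 + l u)\<^bsup>y/l\<^esup>\<close>, for a real number \<open>u\<close> and for a formal
  power series \<open>u\<close>; \<open>e\<^sub>l\<^sup>y(t)\<close> is the latter at \<^term>\<open>fps_X\<close>.
\<close>

definition deg_exp :: "real \<Rightarrow> real \<Rightarrow> real \<Rightarrow> real" where
  "deg_exp l y u = (1 + l * u) powr (y / l)"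

definition deg_exp_fps :: "real \<Rightarrow> real \<Rightarrow> real fps \<Rightarrow> real fps" where
  "deg_exp_fps l y U = fps_rpow (1 + fps_const l * U) (y / l)"

text \<open>
  \<^term>\<open>deg_rStirling l r n k\<close> is the degenerate \<open>r\<close>-Stirling number with upper entry \<open>n + r\<close> and
  lower entry \<open>k + r\<close>.
\<close>

definition deg_rStirling :: "real \<Rightarrow> nat \<Rightarrow> nat \<Rightarrow> nat \<Rightarrow> real" where
  "deg_rStirling l r n k =
     fact n * fps_nth (fps_const (1 / fact k) * (deg_exp_fps l 1 fps_X - 1) ^ k
                  * deg_exp_fps l (real r) fps_X) n"

definition deg_rBell :: "real \<Rightarrow> nat \<Rightarrow> nat \<Rightarrow> real \<Rightarrow> real" where
  "deg_rBell l r n x =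
     fact n * fps_nth (deg_exp_fps l 1 (fps_const x * deg_exp_fps l 1 fps_X)
                  * deg_exp_fps l (real r) fps_X / fps_const (deg_exp l 1 x)) n"

definition deg_rBell2 :: "real \<Rightarrow> nat \<Rightarrow> nat \<Rightarrow> real \<Rightarrow> real \<Rightarrow> real" where
  "deg_rBell2 l r n x y =
     fact n * fps_nth (deg_exp_fps l y (fps_const x * deg_exp_fps l 1 fps_X)
                  * deg_exp_fps l (real r) fps_X / fps_const (deg_exp l 1 x)) n"

lemma fps_rpow_of_nat:
  assumes "fps_nth F 0 > 0"
  shows   "fps_rpow F (real n) = F ^ n"
proof -
  let ?c = "fps_nth F 0"
  define U where "U = F / fps_const ?c - 1"
  have U: "1 + U = fps_const (inverse ?c) * F"
    using assms by (simp add: U_def fps_divide_unit fps_const_inverse mult.commute)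
  have U0: "fps_nth U 0 = 0"
    using assms arg_cong [OF U, of "\<lambda>G. fps_nth G 0"] by simp
  have "fps_rpow F (real n) = fps_const ?c ^ n * ((1 + fps_X) ^ n oo U)"
    using assms by (simp add: fps_rpow_def fps_binomial_of_nat powr_realpow U_def)
  also have "(1 + fps_X) ^ n oo U = (1 + U) ^ n"
    using U0 by (simp add: fps_compose_add_distrib flip: fps_compose_power)
  also have "fps_const ?c ^ n * (1 + U) ^ n = (fps_const ?c * fps_const (inverse ?c) * F) ^ n"
    by (simp only: U power_mult_distrib mult.assoc)
  also have "\<dots> = F ^ n" using assms by simp
  finally show ?thesis .
qed

text \<open>
  The constant term and the differential equation \<open>F (F\<^sup>a)' = a F' F\<^sup>a\<close> determine \<open>F\<^sup>a\<close>.
\<close>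

lemma fps_rpow_nth_0: "fps_nth (fps_rpow F a) 0 = fps_nth F 0 powr a"
  by (simp add: fps_rpow_def)

lemma fps_deriv_rpow:
  assumes "fps_nth F 0 > 0"
  shows   "F * fps_deriv (fps_rpow F a) = fps_const a * fps_deriv F * fps_rpow F a"
proof -
  let ?c = "fps_nth F 0"
  define U where "U = F / fps_const ?c - 1"
  have U: "1 + U = fps_const (inverse ?c) * F"
    using assms by (simp add: U_def fps_divide_unit fps_const_inverse mult.commute)
  have U0: "fps_nth U 0 = 0"
    using assms arg_cong [OF U, of "\<lambda>G. fps_nth G 0"] by simp
  have F: "F = fps_const ?c * (1 + U)"
  proof -
    have "fps_const ?c * (1 + U) = (fps_const ?c * fps_const (inverse ?c)) * F"
      by (simp only: U mult.assoc)
    then show ?thesis using assms by simp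
  qed
  have dF: "fps_deriv F = fps_const ?c * fps_deriv U"
    by (subst F) simp
  have R: "fps_rpow F a = fps_const (?c powr a) * (fps_binomial a oo U)"
    by (simp add: fps_rpow_def U_def)
  have "(1 + fps_X) * fps_deriv (fps_binomial a) = fps_const a * fps_binomial a"
    using inverse_mult_eq_1' [of "1 + fps_X :: real fps"]
    by (simp add: fps_binomial_deriv fps_divide_unit mult.left_commute)
  then have "((1 + fps_X) * fps_deriv (fps_binomial a)) oo U = (fps_const a * fps_binomial a) oo U"
    by simp
  then have ode: "(1 + U) * (fps_deriv (fps_binomial a) oo U) = fps_const a * (fps_binomial a oo U)"
    using U0 by (simp add: fps_compose_mult_distrib fps_compose_add_distrib)
  have "F * fps_deriv (fps_rpow F a) =
          fps_const ?c * fps_const (?c powr a) * fps_deriv U *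
            ((1 + U) * (fps_deriv (fps_binomial a) oo U))"
    by (subst F) (simp add: R fps_compose_deriv [OF U0] mult_ac del: fps_const_mult)
  also have "\<dots> = fps_const a * fps_deriv F * fps_rpow F a"
    by (simp only: ode dF R mult_ac)
  finally show ?thesis .
qed

lemma deg_exp_fps_X_nth:
  assumes "l \<noteq> 0"
  shows   "fps_nth (deg_exp_fps l x fps_X) n = deg_ffact l x n / fact n"
proof -
  have "deg_exp_fps l x fps_X = fps_binomial (x / l) oo (fps_const l * fps_X)"
    by (simp add: deg_exp_fps_def fps_rpow_def)
  also have "fps_nth \<dots> n = l ^ n * ((x / l) gchoose n)"
    by (simp add: fps_compose_linear)
  also have "\<dots> = (\<Prod>i<n. l * (x / l - real i)) / fact n"
    by (simp add: gbinomial_prod_rev prod.distrib atLeast0LessThan)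
  also have "(\<lambda>i. l * (x / l - real i)) = (\<lambda>i. x - real i * l)"
    using assms by (auto simp: fun_eq_iff field_simps)
  finally show ?thesis by (simp add: deg_ffact_def)
qed

end

theory Submission
  imports Defs
begin

text \<open>
  With \<open>E = e\<^sub>l(t)\<close> and \<open>c = 1 + l x\<close>, the base splits as
  \<open>1 + l x E = c (1 + (l x / c) (E - 1))\<close>. Expanding the power \<open>y/l\<close> by the binomial series in
  \<open>E - 1\<close>, whose powers times \<open>e\<^sub>l\<^sup>r(t)\<close> generate the degenerate \<open>r\<close>-Stirling numbers, gives the
  formula, and dividing by \<open>e\<^sub>l(x)\<close> turns the prefactor \<open>c\<^bsup>y/l\<^esup>\<close> into \<open>e\<^sub>l\<^bsup>y-1\<^esup>(x)\<close>.
\<close>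

text \<open>As \<open>U\<close> has no constant term, \<open>U ^ k\<close> starts in degree
  \<open>k\<close> or later. Hence for every \<open>m \<le> n\<close> the sum for coefficient
  \<open>m\<close> of \<open>G oo U\<close> can be padded with zeros to the common range
  \<open>0..n\<close>, and the convolution with \<open>R\<close> can then be interchanged with
  it.\<close>

lemma fps_compose_mult_nth:
  fixes G U R :: "'a::comm_ring_1 fps"
  assumes "fps_nth U 0 = 0"
  shows "fps_nth ((G oo U) * R) n = (\<Sum>k=0..n. fps_nth G k * fps_nth (U ^ k * R) n)"
proof -
  have "fps_nth (G oo U) m = (\<Sum>k=0..n. fps_nth G k * fps_nth (U ^ k) m)" if "m \<le> n" for m
    unfolding fps_compose_nth using that assms
    by (intro sum.mono_neutral_left) (auto simp: startsby_zero_power_prefix)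
  then have "fps_nth ((G oo U) * R) n =
      (\<Sum>m=0..n. \<Sum>k=0..n. fps_nth G k * fps_nth (U ^ k) m * fps_nth R (n - m))"
    by (simp add: fps_mult_nth sum_distrib_right)
  also have "\<dots> = (\<Sum>k=0..n. fps_nth G k * fps_nth (U ^ k * R) n)"
    by (subst sum.swap) (simp add: fps_mult_nth sum_distrib_left mult.assoc)
  finally show ?thesis .
qed

text \<open>Each of the \<open>k\<close> factors \<open>l\<close> is absorbed by one factor
  \<open>y / l - i\<close>. This links the coefficients of the binomial series to the degenerate
  factorials.\<close>

lemma deg_ffact_conv_gchoose:
  assumes "l \<noteq> 0"
  shows "deg_ffact l y k = fact k * l ^ k * ((y / l) gchoose k)"
proof -
  have "fact k * l ^ k * ((y / l) gchoose k) = (\<Prod>i<k. l * (y / l - real i))"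
    by (simp add: gbinomial_prod_rev prod.distrib atLeast0LessThan)
  also have "(\<lambda>i. l * (y / l - real i)) = (\<lambda>i. y - real i * l)"
    using assms by (auto simp: fun_eq_iff field_simps)
  finally show ?thesis by (simp add: deg_ffact_def)
qed

lemma deg_exp_fps_deg_exp_fps_X:
  fixes l x y :: real
  assumes "l \<noteq> 0" and "1 + l * x > 0"
  shows "deg_exp_fps l y (fps_const x * deg_exp_fps l 1 fps_X) =
    fps_const (deg_exp l y x) * (fps_binomial (y / l) oo
      (fps_const (l * x / (1 + l * x)) * (deg_exp_fps l 1 fps_X - 1)))"
proof -
  define E where "E = deg_exp_fps l 1 fps_X"
  define c where "c = 1 + l * x"
  have "fps_nth E 0 = 1"
    using assms by (simp add: E_def deg_exp_fps_X_nth deg_ffact_def)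
  then have F0: "fps_nth (1 + fps_const l * (fps_const x * E)) 0 = c"
    by (simp add: c_def)
  have "c \<noteq> 0" using assms by (simp add: c_def)
  \<comment> \<open>\<open>c\<close> is the constant term that \<open>fps_rpow\<close> divides out.
    What remains is the argument of the binomial series, because
    \<open>1 + l x E = c + l x (E - 1)\<close>.\<close>
  have "(1 + fps_const l * (fps_const x * E)) / fps_const c - 1 =
      fps_const (l * x / c) * (E - 1)"
  proof -
    have "fps_const c * (1 + fps_const (l * x / c) * (E - 1)) =
        fps_const c + fps_const (l * x) * (E - 1)"
      using \<open>c \<noteq> 0\<close> by (simp add: distrib_left flip: mult.assoc)
    also have "\<dots> = 1 + fps_const l * (fps_const x * E)"
      by (simp add: c_def right_diff_distrib flip: fps_const_add mult.assoc)
    finally have "1 + fps_const l * (fps_const x * E) =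
        fps_const c * (1 + fps_const (l * x / c) * (E - 1))" ..
    moreover have "fps_const c \<noteq> 0"
      using \<open>c \<noteq> 0\<close> by simp
    ultimately show ?thesis
      using nonzero_mult_div_cancel_left[of "fps_const c" "1 + fps_const (l * x / c) * (E - 1)"]
      by (metis add_diff_cancel_left')
  qed
  then show ?thesis
    unfolding deg_exp_fps_def[of l y] fps_rpow_def F0[unfolded E_def]
    by (simp add: deg_exp_def E_def c_def)
qed

lemma deg_rBell2_eq_sum:
  fixes l x y :: real
  assumes "l \<noteq> 0" and "1 + l * x > 0"
  shows "deg_rBell2 l r n x y = deg_exp l (y - 1) x *
    (\<Sum>k=0..n. deg_ffact l y k * (x / (1 + l * x)) ^ k * deg_rStirling l r n k)"
proof -
  define W where "W = deg_exp_fps l 1 fps_X - 1"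
  define R where "R = deg_exp_fps l (real r) fps_X"
  define q where "q = l * x / (1 + l * x)"
  have W0: "fps_nth (fps_const q * W) 0 = 0"
    using assms by (simp add: W_def deg_exp_fps_X_nth deg_ffact_def)
  have exp_ne: "deg_exp l 1 x \<noteq> 0"
    using assms by (simp add: deg_exp_def)
  have exp_div: "deg_exp l y x / deg_exp l 1 x = deg_exp l (y - 1) x"
    using assms by (simp add: deg_exp_def powr_diff diff_divide_distrib)
  \<comment> \<open>The factor \<open>l ^ k\<close> contained in \<open>q ^ k\<close>, together with
    a \<open>fact k\<close> compensating the \<open>1 / fact k\<close> in the Stirling number, turns
    \<open>(y / l) gchoose k\<close> into \<open>deg_ffact l y k\<close>.\<close>
  have coeff: "fact n * (((y / l) gchoose k) * fps_nth ((fps_const q * W) ^ k * R) n) =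
      deg_ffact l y k * (x / (1 + l * x)) ^ k * deg_rStirling l r n k" for k
  proof -
    have "fps_nth ((fps_const q * W) ^ k * R) n = q ^ k * fps_nth (W ^ k * R) n"
      by (simp add: power_mult_distrib fps_const_power mult.assoc)
    moreover have "deg_rStirling l r n k = fact n * (fps_nth (W ^ k * R) n / fact k)"
      by (simp add: deg_rStirling_def W_def R_def mult.assoc)
    ultimately show ?thesis
      using assms by (simp add: deg_ffact_conv_gchoose q_def power_mult_distrib power_divide)
  qed
  have "deg_rBell2 l r n x y = fact n *
      (deg_exp l y x * fps_nth ((fps_binomial (y / l) oo (fps_const q * W)) * R) n / deg_exp l 1 x)"
    unfolding deg_rBell2_def deg_exp_fps_deg_exp_fps_X[OF assms] q_def W_def R_def
    using exp_ne by (simp add: fps_divide_unit fps_const_inverse mult.assoc mult.commute[of _ "fps_const _"]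
      divide_inverse mult.commute[of _ "inverse _"] del: fps_const_mult)
  also have "\<dots> = deg_exp l (y - 1) x *
      (fact n * fps_nth ((fps_binomial (y / l) oo (fps_const q * W)) * R) n)"
    by (simp flip: exp_div)
  also have "fact n * fps_nth ((fps_binomial (y / l) oo (fps_const q * W)) * R) n =
      (\<Sum>k=0..n. deg_ffact l y k * (x / (1 + l * x)) ^ k * deg_rStirling l r n k)"
    by (simp only: fps_compose_mult_nth[OF W0] sum_distrib_left fps_binomial_nth coeff)
  finally show ?thesis .
qed

theorem theorem2p12:
  fixes l x y :: real and r n :: nat
  assumes "l \<noteq> 0" and "1 + l * x > 0"
  shows "deg_rBell2 l r n x y =
           deg_exp l (y - 1) x *
             (\<Sum>k=0..n. deg_ffact l y k * (x / (1 + l * x)) ^ k * deg_rStirling l r n k)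
       \<and> deg_rBell2 l r n x 1 =
           (\<Sum>k=0..n. deg_ffact l 1 k * (x / (1 + l * x)) ^ k * deg_rStirling l r n k)
       \<and> (\<Sum>k=0..n. deg_ffact l 1 k * (x / (1 + l * x)) ^ k * deg_rStirling l r n k) =
           deg_rBell l r n x"
proof -
  have "deg_exp l 0 x = 1"
    using assms by (simp add: deg_exp_def)
  then have "deg_rBell2 l r n x 1 =
      (\<Sum>k=0..n. deg_ffact l 1 k * (x / (1 + l * x)) ^ k * deg_rStirling l r n k)"
    using deg_rBell2_eq_sum[OF assms, of r n 1] by simp
  \<comment> \<open>At \<open>y = 1\<close> the two defining series coincide literally.\<close>
  moreover have "deg_rBell2 l r n x 1 = deg_rBell l r n x"
    by (simp only: deg_rBell2_def deg_rBell_def)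
  ultimately show ?thesis
    using deg_rBell2_eq_sum[OF assms, of r n y] by metis
qed

end
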